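(* Let $q$ be a prime power, $k$ a positive integer, and let $f\in\mathcal{L}_{k,q}$ be a linearized polynomial over $\mathbb{F}_{q^k}$. For $\gamma$ algebraic over $\mathbb{F}_{q^k}$ put $V_{f,\gamma}=\{u+f(u)\gamma : u\in\mathbb{F}_{q^k}\}\subseteq\mathbb{F}_{q^k}(\gamma)$. Then: 1. If $\gamma$ is a root of an irreducible polynomial of degree at least two over $\mathbb{F}_{q^k}$, then $V_{f,\gamma}$ is a Sidon space if and only if $f$ is a Sidon space polynomial with respect to $\gamma$. 2. $V_{f,\gamma}$ is a Sidon space for every $\gamma$ such that $[\mathbb{F}_{q^k}(\gamma):\mathbb{F}_{q^k}]>2$ if and only if $f$ is a Sidon space polynomial.
   Context: $\mathcal{L}_{k,q}$ is the set of linearized polynomials ($q$-polynomials) $\sum_{i=0}^{t}f_ix^{q^i}$ with $f_i\in\mathbb{F}_{q^k}$; each is identified with the $\mathbb{F}_q$-linear map $\mathbb{F}_{q^k}\to\mathbb{F}_{q^k}$ it defines. An $\mathbb{F}_q$-subspace $V$ of a finite extension field of $\mathbb{F}_q$ is a Sidon space if for all nonzero $a,b,c,d\in V$ with $ab=cd$ one has $\{a\mathbb{F}_q,b\mathbb{F}_q\}=\{c\mathbb{F}_q,d\mathbb{F}_q\}$, where $e\mathbb{F}_q=\{e\lambda:\lambda\in\mathbb{F}_q\}$. For $x_0\in\mathbb{F}_{q^k}$ put $S^\gamma_{x_0,f}=\{\lambda\in\mathbb{F}_{q^k}(\gamma) : \lambda(x_0+f(x_0)\gamma)\in V_{f,\gamma}\}$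 and $S_{x_0,f}=\{\lambda\in\mathbb{F}_{q^k} : f(\lambda x_0)=\lambda f(x_0)\}$. The polynomial $f$ is a Sidon space polynomial with respect to $\gamma$ if $S^\gamma_{x_0,f}\cap S^\gamma_{x_1,f}=\mathbb{F}_q$ for all $x_0,x_1\in\mathbb{F}_{q^k}$ that are not $\mathbb{F}_q$-proportional (i.e. that are $\mathbb{F}_q$-linearly independent); it is a Sidon space polynomial if $S_{x_0,f}\cap S_{x_1,f}=\mathbb{F}_q$ for all such $x_0,x_1$. *)

theory Defs
  imports
    "HOL-Algebra.Algebraic_Closure_Type"
    "HOL-Algebra.Generated_Fields"
    "HOL-Number_Theory.Prime_Powers"
begin

text \<open>
  The type \<open>'a\<close> plays the role of $F_{q^k}$, a set \<open>F :: 'a set\<close> (a subfield with \<open>q\<close>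
  elements) that of $F_q$. Elements algebraic over $F_{q^k}$ are taken in the algebraic
  closure \<open>'a alg_closure\<close>, into which \<open>'a\<close> embeds via \<^const>\<open>to_ac\<close>; every simple
  algebraic extension of \<open>'a\<close> is isomorphic over \<open>'a\<close> to a subfield of it.
\<close>

definition linearized_polys :: "nat \<Rightarrow> 'a::field poly set" where
  "linearized_polys q = {\<Sum>i\<le>t. Polynomial.monom (c i) (q ^ i) | (c :: nat \<Rightarrow> 'a) t. True}"

definition subspace_over :: "'b::field set \<Rightarrow> 'b set \<Rightarrow> bool" where
  "subspace_over F V \<longleftrightarrow>
     0 \<in> V \<and> (\<forall>u\<in>V. \<forall>v\<in>V. u + v \<in> V) \<and> (\<forall>c\<in>F. \<forall>v\<in>V. c * v \<in> V)"

definition sidon_space :: "'b::field set \<Rightarrow> 'b set \<Rightarrow> bool" where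
  "sidon_space F V \<longleftrightarrow> subspace_over F V \<and>
     (\<forall>a\<in>V - {0}. \<forall>b\<in>V - {0}. \<forall>c\<in>V - {0}. \<forall>d\<in>V - {0}. a * b = c * d \<longrightarrow>
        {{a * l | l. l \<in> F}, {b * l | l. l \<in> F}} = {{c * l | l. l \<in> F}, {d * l | l. l \<in> F}})"

definition simple_ext :: "'a::field alg_closure \<Rightarrow> 'a alg_closure set" where
  "simple_ext \<gamma> = generate_field ring_of_type_algebra (insert \<gamma> (range to_ac))"

lemma vector_space_to_ac: "vector_space (\<lambda>c x. to_ac (c :: 'a::field) * x)"
  by unfold_locales (simp_all add: algebra_simps)

text \<open>
  The library dimension is 0 for infinite-dimensional spaces; this does not occur here, since
  every \<open>\<gamma>\<close> in the algebraic closure is algebraic.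
\<close>
definition ext_degree :: "'a::field alg_closure \<Rightarrow> nat" where
  "ext_degree \<gamma> = vector_space.dim (\<lambda>c x. to_ac (c :: 'a) * x) (simple_ext \<gamma>)"

definition V_space :: "'a::field poly \<Rightarrow> 'a alg_closure \<Rightarrow> 'a alg_closure set" where
  "V_space f \<gamma> = {to_ac u + to_ac (poly f u) * \<gamma> | u. True}"

definition S_gamma :: "'a::field alg_closure \<Rightarrow> 'a poly \<Rightarrow> 'a \<Rightarrow> 'a alg_closure set" where
  "S_gamma \<gamma> f x0 =
     {l \<in> simple_ext \<gamma>. l * (to_ac x0 + to_ac (poly f x0) * \<gamma>) \<in> V_space f \<gamma>}"

definition S_set :: "'a::field poly \<Rightarrow> 'a \<Rightarrow> 'a set" where
  "S_set f x0 = {l. poly f (l * x0) = l * poly f x0}"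

definition lin_indep2 :: "'a::field set \<Rightarrow> 'a \<Rightarrow> 'a \<Rightarrow> bool" where
  "lin_indep2 F x0 x1 \<longleftrightarrow>
     (\<forall>a\<in>F. \<forall>b\<in>F. a * x0 + b * x1 = 0 \<longrightarrow> a = 0 \<and> b = 0)"

definition sidon_space_poly_wrt :: "'a::field set \<Rightarrow> 'a alg_closure \<Rightarrow> 'a poly \<Rightarrow> bool" where
  "sidon_space_poly_wrt F \<gamma> f \<longleftrightarrow>
     (\<forall>x0 x1. lin_indep2 F x0 x1 \<longrightarrow> S_gamma \<gamma> f x0 \<inter> S_gamma \<gamma> f x1 = to_ac ` F)"

definition sidon_space_poly :: "'a::field set \<Rightarrow> 'a poly \<Rightarrow> bool" where
  "sidon_space_poly F f \<longleftrightarrow>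
     (\<forall>x0 x1. lin_indep2 F x0 x1 \<longrightarrow> S_set f x0 \<inter> S_set f x1 = F)"

end

theory Submission
  imports Defs "HOL-Number_Theory.Residues"
begin

text \<open>
  If \<open>\<gamma>\<close> has degree greater than 2, then \<open>1, \<gamma>, \<gamma>\<^sup>2\<close> are linearly independent, so a relation
  \<open>\<lambda> (x\<^sub>i + f(x\<^sub>i) \<gamma>) = y\<^sub>i + f(y\<^sub>i) \<gamma>\<close> for \<open>i = 0, 1\<close> becomes, after eliminating \<open>\<lambda>\<close>, three
  equations in the base field. They force \<open>y\<^sub>i = \<mu> x\<^sub>i\<close> for a common \<open>\<mu>\<close>, and the Sidon condition
  on \<open>f\<close> puts \<open>\<mu>\<close> into \<open>F\<close>. Conversely \<open>S\<^sub>x \<subseteq> S\<^sub>x\<^sup>\<gamma>\<close> for any \<open>\<gamma>\<close>, and a \<open>\<gamma>\<close> of degree greater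
  than 2 exists because the algebraic closure is infinite, whereas only finitely many elements
  are roots of the finitely many polynomials of degree at most 2.
\<close>

section \<open>Field types as algebraic structures\<close>

lemma ring_of_type_simps [simp]:
  "carrier (ring_of_type_algebra :: 'b::field ring) = UNIV"
  "monoid.mult (ring_of_type_algebra :: 'b ring) = (*)"
  "monoid.one (ring_of_type_algebra :: 'b ring) = 1"
  "ring.zero (ring_of_type_algebra :: 'b ring) = 0"
  "ring.add (ring_of_type_algebra :: 'b ring) = (+)"
  by (simp_all add: ring_of_type_algebra_def)

lemma ring_of_type_a_inv [simp]: "a_inv (ring_of_type_algebra :: 'b::field ring) x = - x"
proof -
  interpret field "ring_of_type_algebra :: 'b ring" by (rule field_from_type_algebra)
  show ?thesis using minus_equality[of "-x" x] by simp
qed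

lemma ring_of_type_m_inv [simp]:
  assumes "x \<noteq> 0"
  shows "m_inv (ring_of_type_algebra :: 'b::field ring) x = inverse x"
proof -
  interpret field "ring_of_type_algebra :: 'b ring" by (rule field_from_type_algebra)
  show ?thesis using comm_inv_char[of x "inverse x"] assms by simp
qed

lemma subfield_ring_of_typeD:
  assumes "subfield F (ring_of_type_algebra :: 'b::field ring)"
  shows "0 \<in> F" "1 \<in> F" "x \<in> F \<Longrightarrow> y \<in> F \<Longrightarrow> x * y \<in> F" "x \<in> F \<Longrightarrow> - x \<in> F"
    "x \<in> F \<Longrightarrow> inverse x \<in> F"
proof -
  interpret field "ring_of_type_algebra :: 'b ring" by (rule field_from_type_algebra)
  note sub = subringE[OF subfieldE(1)[OF assms]]
  show "0 \<in> F" "1 \<in> F" "x \<in> F \<Longrightarrow> y \<in> F \<Longrightarrow> x * y \<in> F" "x \<in> F \<Longrightarrow> - x \<in> F"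
    using sub by auto
  then show "x \<in> F \<Longrightarrow> inverse x \<in> F"
    using subfield_m_inv(1)[OF assms, of x] by (cases "x = 0") auto
qed

section \<open>Linearized polynomials as \<open>F\<close>-linear maps\<close>

text \<open>Fermat's argument: multiplication by a nonzero \<open>x\<close> permutes
  \<open>F - {0}\<close>, so the product of all nonzero elements can be cancelled.\<close>

lemma subfield_power_card:
  fixes F :: "'b::{field,finite} set"
  assumes "subfield F (ring_of_type_algebra :: 'b ring)" "x \<in> F"
  shows "x ^ card F = x"
proof (cases "x = 0")
  case True
  \<comment> \<open>The exponent must be positive, since \<open>0 ^ 0 = 1\<close>.\<close>
  have "card F > 0"
    using assms(2) by (simp add: card_gt_0_iff) blast
  with True show ?thesis by simp
next
  case False
  note F = subfield_ring_of_typeD[OF assms(1)]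
  have card: "Suc (card (F - {0})) = card F"
    using F(1) by (intro card_Suc_Diff1) simp_all
  have inv: "inverse x \<in> F" using F(5) assms(2) by blast
  have "(\<Prod>y\<in>F-{0}. x * y) = (\<Prod>y\<in>F-{0}. y)"
    by (rule prod.reindex_bij_witness[of _ "\<lambda>y. inverse x * y" "\<lambda>y. x * y"])
      (use False F(3)[OF inv] F(3)[OF assms(2)] in auto)
  then have "x ^ card (F - {0}) * (\<Prod>y\<in>F-{0}. y) = (\<Prod>y\<in>F-{0}. y)"
    by (simp add: prod.distrib)
  then have "x ^ card (F - {0}) = 1"
    by simp
  then show ?thesis
    by (simp flip: card)
qed

text \<open>The characteristic divides \<open>q ^ k\<close>, hence is the prime underlying
  \<open>q\<close>. This makes raising to the power \<open>q ^ i\<close> an iterated Frobenius map,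
  which is additive.\<close>

lemma CHAR_of_card:
  assumes "primepow q" "card (UNIV :: 'b::{field,finite} set) = q ^ k"
  shows "prime CHAR('b)" "\<exists>m. q = CHAR('b) ^ m"
proof -
  show pr: "prime CHAR('b)"
    using finite_imp_CHAR_pos[where ?'a='b] by (intro prime_CHAR_semidom) auto
  obtain r m where q: "prime r" "q = r ^ m"
    using assms(1) by (auto simp: primepow_def)
  have "CHAR('b) dvd r ^ (m * k)"
    using CHAR_dvd_CARD[where ?'a='b] assms(2) q by (simp add: power_mult)
  then have "CHAR('b) = r"
    using pr q(1) by (metis prime_dvd_power primes_dvd_imp_eq)
  with q show "\<exists>m. q = CHAR('b) ^ m" by blast
qed

lemma linearized_poly_add:
  fixes f :: "'b::{field,finite} poly"
  assumes "primepow q" "card (UNIV :: 'b set) = q ^ k" "f \<in> linearized_polys q"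
  shows "poly f (x + y) = poly f x + poly f y"
proof -
  obtain c t where f: "f = (\<Sum>i\<le>t. Polynomial.monom (c i) (q ^ i))"
    using assms(3) by (auto simp: linearized_polys_def)
  obtain m where "q = CHAR('b) ^ m"
    using CHAR_of_card[OF assms(1,2)] by blast
  then have "(x + y) ^ (q ^ i) = x ^ (q ^ i) + y ^ (q ^ i)" for i
    using freshmans_dream'[OF CHAR_of_card(1)[OF assms(1,2)], of "q ^ i" "m * i"]
    by (simp add: power_mult)
  then show ?thesis
    by (simp add: f poly_sum poly_monom distrib_left sum.distrib)
qed

lemma linearized_poly_scale:
  fixes f :: "'b::{field,finite} poly"
  assumes "subfield F (ring_of_type_algebra :: 'b ring)" "card F = q"
    "f \<in> linearized_polys q" "c \<in> F"
  shows "poly f (c * x) = c * poly f x"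
proof -
  obtain d t where f: "f = (\<Sum>i\<le>t. Polynomial.monom (d i) (q ^ i))"
    using assms(3) by (auto simp: linearized_polys_def)
  have "c ^ (q ^ i) = c" for i
    by (induction i) (use subfield_power_card[OF assms(1,4)] assms(2) in \<open>simp_all add: power_mult\<close>)
  then show ?thesis
    by (simp add: f poly_sum poly_monom power_mult_distrib sum_distrib_left mult_ac)
qed

section \<open>Polynomials over the base field and their roots in the closure\<close>

lemma map_poly_to_ac_add: "map_poly to_ac (p + r) = map_poly to_ac p + map_poly to_ac r"
  by (rule poly_eqI) (simp add: coeff_map_poly)

lemma map_poly_to_ac_mult: "map_poly to_ac (p * r) = map_poly to_ac p * map_poly to_ac r"
  by (rule poly_eqI) (simp add: coeff_map_poly coeff_mult to_ac_sum)

lemma poly_map_poly_to_ac: "poly (map_poly to_ac p) (to_ac x) = to_ac (poly p x)"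
  by (induction p) (simp_all add: map_poly_pCons)

text \<open>A root in the base field splits off a linear factor; by irreducibility the cofactor is a
  unit, so \<open>p\<close> would have degree at most 1.\<close>

lemma irreducible_root_notin_range:
  fixes p :: "'b::field poly"
  assumes "Factorial_Ring.irreducible p" "Polynomial.degree p \<ge> 2"
    "poly (map_poly to_ac p) \<gamma> = 0"
  shows "\<gamma> \<notin> range to_ac"
proof
  assume "\<gamma> \<in> range to_ac"
  then obtain a where "poly p a = 0"
    using assms(3) by (auto simp: poly_map_poly_to_ac)
  then obtain r where r: "p = [:-a, 1:] * r"
    by (auto simp: poly_eq_0_iff_dvd)
  have "\<not> [:-a, 1:] dvd (1 :: 'b poly)"
    by (simp add: is_unit_pCons_iff)
  then have "r dvd 1"
    using Factorial_Ring.irreducibleD[OF assms(1) r] by blast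
  then have "Polynomial.degree r = 0"
    by (metis Polynomial.degree_1 dvd_imp_degree_le le_zero_eq one_neq_zero)
  moreover have "Polynomial.degree p \<le> Polynomial.degree [:-a, 1:] + Polynomial.degree r"
    unfolding r by (rule degree_mult_le)
  ultimately show False
    using assms(2) by simp
qed

lemma finite_polys_degree_less:
  "finite {p :: 'b::{zero,finite} poly. Polynomial.degree p < n}"
proof (rule finite_subset)
  show "{p :: 'b poly. Polynomial.degree p < n} \<subseteq> Poly ` {xs. set xs \<subseteq> UNIV \<and> length xs \<le> n}"
  proof
    fix p :: "'b poly" assume "p \<in> {p. Polynomial.degree p < n}"
    \<comment> \<open>A nonzero polynomial has one more coefficient than its degree; the zero
      polynomial has the empty list.\<close>
    then have "length (coeffs p) \<le> n" "p = Poly (coeffs p)"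
      by (cases "p = 0") (auto simp: length_coeffs_degree)
    then show "p \<in> Poly ` {xs. set xs \<subseteq> UNIV \<and> length xs \<le> n}" by blast
  qed
  show "finite (Poly ` {xs :: 'b list. set xs \<subseteq> UNIV \<and> length xs \<le> n})"
    by (intro finite_imageI finite_lists_length_le) simp
qed

text \<open>Over a finite field the product of all \<open>X - a\<close>, plus 1, takes the value 1
  everywhere and so has no root.\<close>

lemma infinite_UNIV_alg_closed: "infinite (UNIV :: 'b::alg_closed_field set)"
proof
  assume fin: "finite (UNIV :: 'b set)"
  define P where "P = (\<Prod>a\<in>(UNIV :: 'b set). [:-a, 1:])"
  have "Polynomial.degree P = card (UNIV :: 'b set)"
    unfolding P_def by (subst degree_prod_eq_sum_degree) auto
  then have "Polynomial.degree (P + 1) > 0"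
    using fin by (subst degree_add_eq_left) (auto simp: card_gt_0_iff)
  then obtain x where "poly (P + 1) x = 0"
    using alg_closed_imp_poly_has_root by blast
  moreover have "poly P x = 0"
    using fin by (auto simp: P_def poly_prod)
  ultimately show False by simp
qed

section \<open>Simple extensions and their degree\<close>

lemma simple_ext_base: "to_ac a \<in> simple_ext \<gamma>"
  and simple_ext_gen: "\<gamma> \<in> simple_ext \<gamma>"
  unfolding simple_ext_def by (auto intro: generate_field.incl)

lemma simple_ext_add: "x \<in> simple_ext \<gamma> \<Longrightarrow> y \<in> simple_ext \<gamma> \<Longrightarrow> x + y \<in> simple_ext \<gamma>"
  and simple_ext_mult: "x \<in> simple_ext \<gamma> \<Longrightarrow> y \<in> simple_ext \<gamma> \<Longrightarrow> x * y \<in> simple_ext \<gamma>"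
  using generate_field.eng_add[of x ring_of_type_algebra _ y]
    generate_field.eng_mult[of x ring_of_type_algebra _ y]
  unfolding simple_ext_def by auto

lemma simple_ext_divide: "x \<in> simple_ext \<gamma> \<Longrightarrow> y \<in> simple_ext \<gamma> \<Longrightarrow> x / y \<in> simple_ext \<gamma>"
proof (cases "y = 0")
  case True
  \<comment> \<open>Division by zero yields 0, which lies in the base field.\<close>
  then show ?thesis using simple_ext_base[of 0 \<gamma>] by simp
next
  case False
  assume "x \<in> simple_ext \<gamma>" "y \<in> simple_ext \<gamma>"
  moreover from this False have "inverse y \<in> simple_ext \<gamma>"
    using generate_field.m_inv[of y ring_of_type_algebra] by (simp add: simple_ext_def)
  ultimately show ?thesis
    using simple_ext_mult by (metis divide_inverse)
qed

text \<open>Reduction modulo \<open>p\<close> makes the set of values closed under sums and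
  products. It is finite, so multiplication by a nonzero element, being injective, is onto and hits
  1; this gives inverses even when \<open>p\<close> is reducible.\<close>

lemma simple_ext_subset_poly:
  fixes p :: "'b::{field,finite} poly"
  assumes "p \<noteq> 0" "Polynomial.degree p \<le> n" "n > 0" "poly (map_poly to_ac p) \<gamma> = 0"
  shows "simple_ext \<gamma> \<subseteq> {poly (map_poly to_ac r) \<gamma> | r. Polynomial.degree r < n}" (is "_ \<subseteq> ?E")
proof -
  have red: "poly (map_poly to_ac r) \<gamma> \<in> ?E" for r
  proof -
    have "map_poly to_ac r = map_poly to_ac (r div p) * map_poly to_ac p + map_poly to_ac (r mod p)"
      by (simp flip: map_poly_to_ac_add map_poly_to_ac_mult)
    then have "poly (map_poly to_ac r) \<gamma> = poly (map_poly to_ac (r mod p)) \<gamma>"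
      using assms(4) by simp
    \<comment> \<open>A zero remainder has degree 0, which is where \<open>n > 0\<close>
      enters.\<close>
    moreover have "Polynomial.degree (r mod p) < n"
      using degree_mod_less[OF assms(1), of r] assms(2,3) by auto
    ultimately show ?thesis by blast
  qed
  have add: "x + y \<in> ?E" if xy: "x \<in> ?E" "y \<in> ?E" for x y
  proof -
    obtain r s :: "'b poly" where "x = poly (map_poly to_ac r) \<gamma>" "y = poly (map_poly to_ac s) \<gamma>"
      using xy by blast
    then show ?thesis using red[of "r + s"] by (simp only: map_poly_to_ac_add poly_add)
  qed
  have mult: "x * y \<in> ?E" if xy: "x \<in> ?E" "y \<in> ?E" for x y
  proof -
    obtain r s :: "'b poly" where "x = poly (map_poly to_ac r) \<gamma>" "y = poly (map_poly to_ac s) \<gamma>"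
      using xy by blast
    then show ?thesis using red[of "r * s"] by (simp only: map_poly_to_ac_mult poly_mult)
  qed
  have base: "to_ac a \<in> ?E" for a
    using red[of "[:a:]"] by (simp add: map_poly_pCons)
  have gen: "\<gamma> \<in> ?E"
    using red[of "[:0, 1:]"] by (simp add: map_poly_pCons)
  have fin: "finite ?E"
    using finite_polys_degree_less[where ?'b='b, of n] by simp
  have inv: "inverse x \<in> ?E" if "x \<in> ?E" "x \<noteq> 0" for x
  proof -
    have "inj_on ((*) x) ?E" using that(2) by (auto simp: inj_on_def)
    moreover have "(*) x ` ?E \<subseteq> ?E" using mult[OF that(1)] by blast
    ultimately have img: "(*) x ` ?E = ?E" by (rule endo_inj_surj[OF fin, rotated])
    have "1 \<in> ?E" using base[of 1] by (simp only: to_ac_1)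
    then have "1 \<in> (*) x ` ?E" by (simp only: img)
    then obtain y where y: "1 = x * y" "y \<in> ?E" by (rule imageE)
    from y(1) have "inverse x = y" by (metis inverse_unique)
    with y(2) show ?thesis by (simp only:)
  qed
  show ?thesis
  proof
    fix x assume "x \<in> simple_ext \<gamma>"
    then have "x \<in> generate_field ring_of_type_algebra (insert \<gamma> (range to_ac))"
      by (simp add: simple_ext_def)
    then show "x \<in> ?E"
    proof (induction rule: generate_field.induct)
      case one
      then show ?case using base[of 1] by simp
    next
      case (incl h)
      then show ?case using base gen by blast
    next
      case (a_inv h)
      then show ?case using mult[OF base[of "-1"]] by simp
    next
      case (m_inv h)
      then show ?case using inv by simp
    next
      case (eng_add h1 h2)
      then show ?case using add by simp
    next
      case (eng_mult h1 h2)
      then show ?case using mult by simp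
    qed
  qed
qed

lemma finite_simple_ext: "finite (simple_ext (\<gamma> :: 'b::{field,finite} alg_closure))"
proof -
  obtain p :: "'b poly" where p: "p \<noteq> 0" "poly (map_poly to_ac p) \<gamma> = 0"
    by (rule alg_closure_algebraic)
  have "finite {poly (map_poly to_ac r) \<gamma> | r. Polynomial.degree r < Suc (Polynomial.degree p)}"
    using finite_polys_degree_less[where ?'b='b, of "Suc (Polynomial.degree p)"] by simp
  then show ?thesis
    using simple_ext_subset_poly[OF p(1) _ _ p(2), of "Suc (Polynomial.degree p)"]
    by (auto intro: finite_subset)
qed

text \<open>A nonzero \<open>p\<close> of degree at most 2 lets {1, \<gamma>} span the extension.
  Without such a \<open>p\<close>, the elements 1, \<gamma> and the square of \<gamma> are
  independent, too many for a basis of two.\<close>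

lemma ext_degree_gt_2_iff:
  fixes \<gamma> :: "'b::{field,finite} alg_closure"
  shows "ext_degree \<gamma> > 2 \<longleftrightarrow>
    (\<forall>p :: 'b poly. Polynomial.degree p \<le> 2 \<and> poly (map_poly to_ac p) \<gamma> = 0 \<longrightarrow> p = 0)"
    (is "_ \<longleftrightarrow> ?R")
proof -
  interpret vs: vector_space "\<lambda>c x. to_ac (c :: 'b) * x"
    by (rule vector_space_to_ac)
  have "?R" if deg: "ext_degree \<gamma> > 2"
  proof (rule ccontr)
    assume "\<not> ?R"
    then obtain p :: "'b poly" where p: "p \<noteq> 0" "Polynomial.degree p \<le> 2" "poly (map_poly to_ac p) \<gamma> = 0"
      by blast
    have "simple_ext \<gamma> \<subseteq> vs.span {1, \<gamma>}"
    proof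
      fix x assume "x \<in> simple_ext \<gamma>"
      then obtain r where r: "x = poly (map_poly to_ac r) \<gamma>" "Polynomial.degree r < 2"
        using simple_ext_subset_poly[OF p(1,2) _ p(3)] by auto
      have "r = [:Polynomial.coeff r 0, Polynomial.coeff r 1:]"
        using r(2) by (intro poly_eqI) (auto simp: coeff_pCons coeff_eq_0 split: nat.split)
      then have "map_poly to_ac r = [:to_ac (Polynomial.coeff r 0), to_ac (Polynomial.coeff r 1):]"
        by (metis map_poly_pCons map_poly_0 to_ac_0)
      then have "x = to_ac (Polynomial.coeff r 0) * 1 + to_ac (Polynomial.coeff r 1) * \<gamma>"
        by (simp add: r(1) mult.commute)
      moreover have "to_ac (Polynomial.coeff r 0) * 1 + to_ac (Polynomial.coeff r 1) * \<gamma> \<in> vs.span {1, \<gamma>}"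
        by (intro vs.span_add vs.span_scale vs.span_base) auto
      ultimately show "x \<in> vs.span {1, \<gamma>}" by simp
    qed
    then have "ext_degree \<gamma> \<le> card {1, \<gamma>}"
      unfolding ext_degree_def by (rule vs.dim_le_card) simp
    also have "\<dots> \<le> 2" by (simp add: card_insert_if)
    finally show False using deg by simp
  qed
  moreover have "ext_degree \<gamma> > 2" if R: ?R
  proof (rule ccontr)
    have ev: "a = 0 \<and> b = 0 \<and> c = 0" if "to_ac a + to_ac b * \<gamma> + to_ac c * \<gamma>\<^sup>2 = 0" for a b c :: 'b
    proof -
      have "poly (map_poly to_ac [:a, b, c:]) \<gamma> = 0"
        using that by (simp add: map_poly_pCons algebra_simps power2_eq_square)
      moreover have "Polynomial.degree [:a, b, c:] \<le> 2"
        by simp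
      ultimately have "[:a, b, c:] = 0" using R by blast
      then show ?thesis by simp
    qed
    assume "\<not> ext_degree \<gamma> > 2"
    moreover obtain B where B: "B \<subseteq> simple_ext \<gamma>" "simple_ext \<gamma> \<subseteq> vs.span B"
        "card B = vs.dim (simple_ext \<gamma>)"
      by (rule vs.basis_exists)
    ultimately have cB: "card B \<le> 2" by (simp add: ext_degree_def)
    have "finite B" using B(1) finite_simple_ext by (rule finite_subset)
    have g: "\<gamma> \<notin> vs.span {1}"
    proof
      assume "\<gamma> \<in> vs.span {1}"
      then obtain a where "\<gamma> = to_ac a" by (auto simp: vs.span_singleton)
      then show False using ev[of "-a" 1 0] by simp
    qed
    have g2: "\<gamma>\<^sup>2 \<notin> vs.span {1, \<gamma>}"
    proof
      assume "\<gamma>\<^sup>2 \<in> vs.span {1, \<gamma>}"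
      then obtain a b where "\<gamma>\<^sup>2 - to_ac a = to_ac b * \<gamma>"
        by (auto simp: vs.span_insert[of 1] vs.span_singleton)
      then show False using ev[of "-a" "-b" 1] by (simp add: algebra_simps)
    qed
    have ind: "vs.independent {\<gamma>\<^sup>2, \<gamma>, 1}"
      using g g2 unfolding insert_commute[of 1 \<gamma>] by (auto simp: vs.independent_insert)
    have "{\<gamma>\<^sup>2, \<gamma>, 1} \<subseteq> vs.span B"
      using B(2) simple_ext_gen[of \<gamma>] simple_ext_base[of 1 \<gamma>] simple_ext_mult[of \<gamma> \<gamma> \<gamma>]
      by (auto simp: power2_eq_square)
    then have "card {\<gamma>\<^sup>2, \<gamma>, 1} \<le> card B"
      using vs.independent_span_bound[OF \<open>finite B\<close> ind] by blast
    \<comment> \<open>Independence of a set literal does not rule out coinciding entries;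
      distinctness comes from the span conditions \<open>g\<close> and \<open>g2\<close>.\<close>
    moreover have "card {\<gamma>\<^sup>2, \<gamma>, 1} = 3"
    proof -
      have "\<gamma> \<noteq> 1" using g vs.span_base[of 1 "{1}"] by auto
      moreover have "\<gamma>\<^sup>2 \<noteq> 1" "\<gamma>\<^sup>2 \<noteq> \<gamma>"
        using g2 vs.span_base[of 1 "{1, \<gamma>}"] vs.span_base[of \<gamma> "{1, \<gamma>}"] by auto
      ultimately show ?thesis by simp
    qed
    ultimately show False using cB by simp
  qed
  ultimately show ?thesis by blast
qed

lemma ext_degree_gt_2_indep:
  fixes a b c :: "'b::{field,finite}"
  assumes "ext_degree \<gamma> > 2" "to_ac a + to_ac b * \<gamma> + to_ac c * \<gamma>\<^sup>2 = 0"
  shows "a = 0" "b = 0" "c = 0"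
proof -
  have "poly (map_poly to_ac [:a, b, c:]) \<gamma> = 0"
    using assms(2) by (simp add: map_poly_pCons algebra_simps power2_eq_square)
  moreover have "Polynomial.degree [:a, b, c:] \<le> 2"
    by simp
  ultimately have "[:a, b, c:] = 0" using assms(1) unfolding ext_degree_gt_2_iff by blast
  then show "a = 0" "b = 0" "c = 0" by simp_all
qed

lemma ext_degree_gt_2_notin_range:
  fixes \<gamma> :: "'b::{field,finite} alg_closure"
  assumes "ext_degree \<gamma> > 2"
  shows "\<gamma> \<notin> range to_ac"
proof
  assume "\<gamma> \<in> range to_ac"
  then obtain a :: 'b where "\<gamma> = to_ac a" by blast
  then show False using ext_degree_gt_2_indep(2)[OF assms, of "-a" 1 0] by simp
qed

lemma ex_ext_degree_gt_2: "\<exists>\<gamma> :: 'b::{field,finite} alg_closure. ext_degree \<gamma> > 2"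
proof -
  define P where "P = {p :: 'b poly. Polynomial.degree p < 3} - {0}"
  have "finite P"
    using finite_polys_degree_less[where ?'b='b, of 3] by (simp add: P_def)
  moreover have "finite {x. poly (map_poly to_ac p) x = 0}" if "p \<in> P" for p
    using that by (intro poly_roots_finite) (auto simp: P_def map_poly_eq_0_iff)
  ultimately have "finite (\<Union>p\<in>P. {x. poly (map_poly to_ac p) x = 0})"
    by blast
  then obtain \<gamma> :: "'b alg_closure" where "\<gamma> \<notin> (\<Union>p\<in>P. {x. poly (map_poly to_ac p) x = 0})"
    using infinite_UNIV_alg_closed[where ?'b="'b alg_closure"] by (metis ex_new_if_finite)
  then have "ext_degree \<gamma> > 2"
    unfolding ext_degree_gt_2_iff by (auto simp: P_def)
  then show ?thesis by blast
qed

section \<open>Sidon spaces and multipliers\<close>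

text \<open>The arguments below rest on the \<open>F\<close>-linearity of \<open>poly f\<close>,
  which was derived above for linearized polynomials.\<close>

locale subfield_linear =
  fixes F :: "'a::{field,finite} set" and f :: "'a poly"
  assumes subfield: "subfield F (ring_of_type_algebra :: 'a ring)"
    and poly_f_add: "\<And>x y. poly f (x + y) = poly f x + poly f y"
    and poly_f_scale: "\<And>c x. c \<in> F \<Longrightarrow> poly f (c * x) = c * poly f x"
begin

lemmas F_closed = subfield_ring_of_typeD[OF subfield]

lemma lin_indep2D:
  assumes "lin_indep2 F x y"
  shows "x \<noteq> 0" "y \<noteq> 0" "c \<in> F \<Longrightarrow> y \<noteq> c * x"
proof -
  show "x \<noteq> 0" "y \<noteq> 0"
    using assms[unfolded lin_indep2_def, rule_format, of 1 0]
      assms[unfolded lin_indep2_def, rule_format, of 0 1] F_closed(1,2) by auto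
  show "y \<noteq> c * x" if "c \<in> F"
    using assms[unfolded lin_indep2_def, rule_format, of "c" "-1"]
      F_closed(2) F_closed(4) that by auto
qed

lemma not_lin_indep2E:
  assumes "\<not> lin_indep2 F x y" "x \<noteq> 0" "y \<noteq> 0"
  obtains c where "c \<in> F" "y = c * x"
proof -
  obtain a b where ab: "a \<in> F" "b \<in> F" "a * x + b * y = 0" "a \<noteq> 0 \<or> b \<noteq> 0"
    using assms(1) by (auto simp: lin_indep2_def)
  then have "b \<noteq> 0" using assms(2) by auto
  have "b * y = - a * x" using ab(3) by (simp add: eq_neg_iff_add_eq_0 add.commute)
  then have "y = (- a * inverse b) * x"
    using \<open>b \<noteq> 0\<close> by (simp add: field_simps)
  then show thesis
    using ab F_closed by (intro that[of "- a * inverse b"]) blast+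
qed

definition v :: "'a alg_closure \<Rightarrow> 'a \<Rightarrow> 'a alg_closure" where
  "v \<gamma> u = to_ac u + to_ac (poly f u) * \<gamma>"

lemma V_space_eq: "V_space f \<gamma> = range (v \<gamma>)"
  by (auto simp: V_space_def v_def)

lemma S_gamma_eq: "S_gamma \<gamma> f x = {l \<in> simple_ext \<gamma>. l * v \<gamma> x \<in> range (v \<gamma>)}"
  by (simp add: S_gamma_def v_def V_space_eq)

lemma v_add: "v \<gamma> (x + y) = v \<gamma> x + v \<gamma> y"
  by (simp add: v_def poly_f_add algebra_simps)

lemma v_scale: "c \<in> F \<Longrightarrow> v \<gamma> (c * x) = to_ac c * v \<gamma> x"
  by (simp add: v_def poly_f_scale algebra_simps)

lemma v_0 [simp]: "v \<gamma> 0 = 0"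
  using poly_f_scale[OF F_closed(1), of 0] by (simp add: v_def)

lemma v_in_simple_ext: "v \<gamma> x \<in> simple_ext \<gamma>"
  unfolding v_def by (intro simple_ext_add simple_ext_mult simple_ext_base simple_ext_gen)

text \<open>If \<open>poly f x\<close> is nonzero, the equation can be solved for \<gamma>, placing
  it in the base field. With additivity this makes \<open>v \<gamma>\<close> injective.\<close>

lemma v_eq_0_iff:
  assumes "\<gamma> \<notin> range to_ac"
  shows "v \<gamma> x = 0 \<longleftrightarrow> x = 0"
proof
  assume *: "v \<gamma> x = 0"
  show "x = 0"
  proof (cases "poly f x = 0")
    case True
    with * show ?thesis by (simp add: v_def)
  next
    case False
    then have "to_ac (poly f x) * \<gamma> = to_ac (poly f x) * to_ac (- x / poly f x)"
      using * by (simp add: v_def eq_neg_iff_add_eq_0 add.commute)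
    then have "\<gamma> = to_ac (- x / poly f x)"
      using False by (simp only: mult_cancel_left to_ac_eq_0_iff) simp
    with assms show ?thesis by blast
  qed
qed simp

lemma v_eq_iff:
  assumes "\<gamma> \<notin> range to_ac"
  shows "v \<gamma> x = v \<gamma> y \<longleftrightarrow> x = y"
  using v_eq_0_iff[OF assms, of "x - y"] v_add[of \<gamma> "x - y" y] by auto

lemma F_subset_S_gamma: "to_ac ` F \<subseteq> S_gamma \<gamma> f x"
  by (auto simp: S_gamma_eq simple_ext_base simp flip: v_scale)

lemma F_subset_S_set: "F \<subseteq> S_set f x"
  by (auto simp: S_set_def poly_f_scale)

lemma subspace_V_space: "subspace_over (to_ac ` F) (V_space f \<gamma>)"
  unfolding subspace_over_def V_space_eq
  by (auto simp flip: v_add v_scale intro: range_eqI[of _ _ 0])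

lemma line_scale:
  assumes "c \<in> F" "c \<noteq> 0"
  shows "{to_ac c * x * l | l. l \<in> to_ac ` F} = {x * l | l. l \<in> to_ac ` F}" (is "?L = ?R")
proof
  show "?L \<subseteq> ?R"
    using assms F_closed(3) by (force simp: mult_ac simp flip: to_ac_mult)
  show "?R \<subseteq> ?L"
  proof
    fix z assume "z \<in> ?R"
    then obtain d where d: "d \<in> F" "z = x * to_ac d" by blast
    then have "z = to_ac c * x * to_ac (inverse c * d)"
      using assms(2) by simp
    then show "z \<in> ?L" using d(1) assms(1) F_closed by blast
  qed
qed

text \<open>
  A relation \<open>a b = c d\<close> in \<open>V\<close> amounts to the single multiplier \<open>c / a = b / d\<close> sending both
  \<open>a\<close> and \<open>d\<close> into \<open>V\<close>.
\<close>
lemma sidon_space_iff_wrt: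
  assumes \<gamma>: "\<gamma> \<notin> range to_ac"
  shows "sidon_space (to_ac ` F) (V_space f \<gamma>) \<longleftrightarrow> sidon_space_poly_wrt F \<gamma> f"
proof
  assume sid: "sidon_space (to_ac ` F) (V_space f \<gamma>)"
  show "sidon_space_poly_wrt F \<gamma> f"
    unfolding sidon_space_poly_wrt_def
  proof (intro allI impI equalityI subsetI)
    fix x0 x1 l assume ind: "lin_indep2 F x0 x1" and l: "l \<in> S_gamma \<gamma> f x0 \<inter> S_gamma \<gamma> f x1"
    show "l \<in> to_ac ` F"
    \<comment> \<open>The Sidon condition speaks of nonzero vectors only, and \<open>l * a\<close>,
      \<open>l * d\<close> must be among them.\<close>
    proof (cases "l = 0")
      case True
      then show ?thesis using F_closed(1) by force
    next
      case False
      define a where "a = v \<gamma> x0"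
      define d where "d = v \<gamma> x1"
      have nz: "a \<noteq> 0" "d \<noteq> 0"
        using lin_indep2D[OF ind] by (simp_all add: a_def d_def v_eq_0_iff[OF \<gamma>])
      have mem: "a \<in> V_space f \<gamma> - {0}" "l * d \<in> V_space f \<gamma> - {0}"
          "l * a \<in> V_space f \<gamma> - {0}" "d \<in> V_space f \<gamma> - {0}" "a * (l * d) = (l * a) * d"
        using nz False l by (auto simp: S_gamma_eq V_space_eq a_def d_def)
      have "{{a * m | m. m \<in> to_ac ` F}, {l * d * m | m. m \<in> to_ac ` F}} =
          {{l * a * m | m. m \<in> to_ac ` F}, {d * m | m. m \<in> to_ac ` F}}"
        by (rule sid[unfolded sidon_space_def, THEN conjunct2, rule_format, OF mem])
      moreover have "1 \<in> to_ac ` F" using F_closed(2) by force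
      \<comment> \<open>The line of \<open>a\<close> equals that of \<open>l * a\<close> or that of
        \<open>d\<close>. The first puts \<open>l\<close> into \<open>F\<close>; the second makes
        \<open>x0\<close>, \<open>x1\<close> dependent, as \<open>v \<gamma>\<close> is
        injective.\<close>
      ultimately consider "l * a \<in> {a * m | m. m \<in> to_ac ` F}" | "d \<in> {a * m | m. m \<in> to_ac ` F}"
        by (smt (verit, ccfv_SIG) doubleton_eq_iff mem_Collect_eq mult_1_right)
      then show ?thesis
      proof cases
        case 1
        then show ?thesis using nz by (auto simp: mult.commute)
      next
        case 2
        then obtain c where "c \<in> F" "v \<gamma> x1 = v \<gamma> (c * x0)"
          by (auto simp: a_def d_def v_scale mult.commute)
        then show ?thesis
          using lin_indep2D(3)[OF ind] by (simp add: v_eq_iff[OF \<gamma>])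
      qed
    qed
  qed (use F_subset_S_gamma in blast)
next
  assume wrt: "sidon_space_poly_wrt F \<gamma> f"
  show "sidon_space (to_ac ` F) (V_space f \<gamma>)"
    unfolding sidon_space_def
  proof (intro conjI ballI impI subspace_V_space)
    fix a b c d
    assume mem: "a \<in> V_space f \<gamma> - {0}" "b \<in> V_space f \<gamma> - {0}" "c \<in> V_space f \<gamma> - {0}" "d \<in> V_space f \<gamma> - {0}"
      and eq: "a * b = c * d"
    obtain x y where x: "a = v \<gamma> x" "x \<noteq> 0" and y: "d = v \<gamma> y" "y \<noteq> 0"
      using mem by (auto simp: V_space_eq v_eq_0_iff[OF \<gamma>])
    define l where "l = c / a"
    have c: "c = l * a" and b: "b = l * d"
      using mem eq by (auto simp: l_def field_simps)
    show "{{a * l | l. l \<in> to_ac ` F}, {b * l | l. l \<in> to_ac ` F}} =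
        {{c * l | l. l \<in> to_ac ` F}, {d * l | l. l \<in> to_ac ` F}}"
    \<comment> \<open>For independent \<open>x\<close>, \<open>y\<close> the multiplier
      \<open>l\<close> lies in \<open>F\<close>, so \<open>c\<close> spans the line of
      \<open>a\<close> and \<open>b\<close> that of \<open>d\<close>. Otherwise the pairing is
      crossed: \<open>d\<close> is an \<open>F\<close>-multiple of \<open>a\<close>, and
      \<open>b\<close> of \<open>c\<close>.\<close>
    proof (cases "lin_indep2 F x y")
      case True
      have "l \<in> simple_ext \<gamma>"
        using mem unfolding l_def V_space_eq by (auto intro: simple_ext_divide v_in_simple_ext)
      then have "l \<in> S_gamma \<gamma> f x \<inter> S_gamma \<gamma> f y"
        using mem b c x y by (auto simp: S_gamma_eq V_space_eq)
      then obtain m where m: "m \<in> F" "l = to_ac m"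
        using wrt True unfolding sidon_space_poly_wrt_def by blast
      then have "m \<noteq> 0" using mem c by auto
      then show ?thesis
        using line_scale[OF m(1)] unfolding b c m(2) by simp
    next
      case False
      then obtain m where m: "m \<in> F" "y = m * x"
        using x y by (elim not_lin_indep2E)
      then have "d = to_ac m * a" "b = to_ac m * c"
        using x y c b by (auto simp: v_scale)
      moreover have "m \<noteq> 0" using m y by auto
      ultimately show ?thesis
        using line_scale[OF m(1)] by (simp add: insert_commute)
    qed
  qed
qed

section \<open>The criterion independent of \<gamma>\<close>

text \<open>When \<open>f\<close> commutes with \<open>l\<close> at \<open>x\<close>, the product of
  \<open>l\<close> and \<open>v \<gamma> x\<close> is \<open>v \<gamma> (l * x)\<close>.\<close>

lemma S_set_imp_S_gamma: "l \<in> S_set f x \<Longrightarrow> to_ac l \<in> S_gamma \<gamma> f x"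
  by (auto simp: S_gamma_eq S_set_def simple_ext_base v_def algebra_simps intro!: range_eqI[of _ _ "l * x"])

lemma sidon_space_poly_imp_wrt:
  assumes sp: "sidon_space_poly F f" and deg: "ext_degree \<gamma> > 2"
  shows "sidon_space_poly_wrt F \<gamma> f"
  unfolding sidon_space_poly_wrt_def
proof (intro allI impI equalityI subsetI)
  fix x0 x1 l assume ind: "lin_indep2 F x0 x1" and l: "l \<in> S_gamma \<gamma> f x0 \<inter> S_gamma \<gamma> f x1"
  note \<gamma> = ext_degree_gt_2_notin_range[OF deg]
  note nz = lin_indep2D(1,2)[OF ind]
  obtain y0 y1 where y: "l * v \<gamma> x0 = v \<gamma> y0" "l * v \<gamma> x1 = v \<gamma> y1"
    using l by (auto simp: S_gamma_eq)
  \<comment> \<open>Both products equal \<open>l * v \<gamma> x0 * v \<gamma> x1\<close>, so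
    \<open>l\<close> drops out. Expanding in powers of \<gamma> leaves three equations over the base
    field.\<close>
  then have "v \<gamma> y0 * v \<gamma> x1 - v \<gamma> y1 * v \<gamma> x0 = 0"
    by (simp flip: y add: algebra_simps)
  then have "to_ac (y0 * x1 - y1 * x0)
      + to_ac (y0 * poly f x1 + poly f y0 * x1 - y1 * poly f x0 - poly f y1 * x0) * \<gamma>
      + to_ac (poly f y0 * poly f x1 - poly f y1 * poly f x0) * \<gamma>\<^sup>2 = 0"
    by (simp add: v_def algebra_simps power2_eq_square)
  note coeffs = ext_degree_gt_2_indep[OF deg this]
  \<comment> \<open>The constant coefficient says that \<open>y0 / x0\<close> and
    \<open>y1 / x1\<close> agree.\<close>
  define \<mu> where "\<mu> = y0 / x0"
  have y0: "y0 = \<mu> * x0" and y1: "y1 = \<mu> * x1"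
    using coeffs(1) nz by (auto simp: \<mu>_def field_simps)
  \<comment> \<open>\<open>e0\<close> and \<open>e1\<close> measure how far \<open>f\<close> is from
    commuting with \<mu> at \<open>x0\<close> and \<open>x1\<close>. In terms of them the other two
    coefficients become the equations \<open>e\<close>; if both vanish, \<mu> lies in both sets
    \<open>S_set\<close>.\<close>
  define e0 where "e0 = poly f y0 - \<mu> * poly f x0"
  define e1 where "e1 = poly f y1 - \<mu> * poly f x1"
  have e: "e0 * x1 = e1 * x0" "e0 * poly f x1 = e1 * poly f x0"
    using coeffs(2,3) unfolding e0_def e1_def y0 y1 by (auto simp: algebra_simps)
  have "\<mu> \<in> F"
  proof (cases "e0 = 0")
    case True
    then have "e1 = 0" using e(1) nz by simp
    then have "\<mu> \<in> S_set f x0 \<inter> S_set f x1"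
      using True by (simp add: S_set_def e0_def e1_def y0 y1)
    then show ?thesis using sp ind unfolding sidon_space_poly_def by blast
  next
    case False
    txt \<open>
      Now \<open>\<lambda> = x1 / x0\<close>, which is not in \<open>F\<close>, is also \<open>y1 / y0\<close>, and \<open>f\<close> commutes with it at both
      \<open>x0\<close> and \<open>y0\<close>; hence \<open>x0\<close> and \<open>y0\<close> are dependent.
    \<close>
    define r where "r = x1 / x0"
    have x1: "x1 = r * x0" using nz by (simp add: r_def)
    have e1: "e1 = r * e0" using e(1) nz by (simp add: x1 mult.commute)
    have f1: "poly f x1 = r * poly f x0"
      using e(2) False unfolding e1 by simp
    have g1: "poly f y1 = r * poly f y0"
      using e1 unfolding e0_def e1_def f1 by (simp add: algebra_simps)
    have "y1 = r * y0" by (simp add: y0 y1 x1)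
    then have rS: "r \<in> S_set f x0 \<inter> S_set f y0"
      using f1 g1 x1 by (simp add: S_set_def)
    have "r \<notin> F" using lin_indep2D(3)[OF ind] x1 by blast
    then have dep: "\<not> lin_indep2 F x0 y0"
      using rS sp unfolding sidon_space_poly_def by blast
    show ?thesis
    \<comment> \<open>\<open>not_lin_indep2E\<close> requires \<open>y0\<close> nonzero;
      \<open>y0 = 0\<close> gives \<mu> = 0 at once.\<close>
    proof (cases "y0 = 0")
      case True
      then show ?thesis using F_closed(1) by (simp add: \<mu>_def)
    next
      case False
      then obtain c where "c \<in> F" "y0 = c * x0"
        using not_lin_indep2E[OF dep nz(1)] by blast
      then show ?thesis using nz by (simp add: \<mu>_def)
    qed
  qed
  then have "l * v \<gamma> x0 = to_ac \<mu> * v \<gamma> x0"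
    by (simp add: y y0 v_scale)
  then have "l = to_ac \<mu>" using nz by (simp add: v_eq_0_iff[OF \<gamma>])
  then show "l \<in> to_ac ` F" using \<open>\<mu> \<in> F\<close> by blast
qed (use F_subset_S_gamma in blast)

lemma sidon_space_poly_wrt_imp:
  assumes "sidon_space_poly_wrt F \<gamma> f"
  shows "sidon_space_poly F f"
  unfolding sidon_space_poly_def
proof (intro allI impI equalityI subsetI)
  fix x0 x1 l assume "lin_indep2 F x0 x1" "l \<in> S_set f x0 \<inter> S_set f x1"
  then have "to_ac l \<in> to_ac ` F"
    using assms S_set_imp_S_gamma unfolding sidon_space_poly_wrt_def by blast
  then show "l \<in> F" by auto
qed (use F_subset_S_set in blast)

text \<open>From left to right a single \<gamma> of degree greater than 2 suffices, and its
  existence keeps the quantifier from being vacuous.\<close>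

lemma sidon_space_all_iff:
  "(\<forall>\<gamma> :: 'a alg_closure. ext_degree \<gamma> > 2 \<longrightarrow> sidon_space (to_ac ` F) (V_space f \<gamma>))
    \<longleftrightarrow> sidon_space_poly F f"
  using ex_ext_degree_gt_2[where ?'b='a] sidon_space_iff_wrt[OF ext_degree_gt_2_notin_range]
    sidon_space_poly_imp_wrt sidon_space_poly_wrt_imp by metis

end

theorem corollary3p13:
  fixes q k :: nat and F :: "'a::{field,finite} set" and f :: "'a poly"
  assumes "primepow q"
    and "k > 0"
    and "card (UNIV :: 'a set) = q ^ k"
    and "subfield F (ring_of_type_algebra :: 'a ring)"
    and "card F = q"
    and "f \<in> linearized_polys q"
  shows "(\<forall>\<gamma> :: 'a alg_closure.
            (\<exists>p :: 'a poly. Factorial_Ring.irreducible p \<and> Polynomial.degree p \<ge> 2 \<and>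
               poly (map_poly to_ac p) \<gamma> = 0) \<longrightarrow>
            (sidon_space (to_ac ` F) (V_space f \<gamma>) \<longleftrightarrow> sidon_space_poly_wrt F \<gamma> f))
       \<and> ((\<forall>\<gamma> :: 'a alg_closure. ext_degree \<gamma> > 2 \<longrightarrow> sidon_space (to_ac ` F) (V_space f \<gamma>))
            \<longleftrightarrow> sidon_space_poly F f)"
proof -
  interpret subfield_linear F f
    by (rule subfield_linear.intro)
      (use assms linearized_poly_add linearized_poly_scale in blast)+
  show ?thesis
    using sidon_space_iff_wrt irreducible_root_notin_range sidon_space_all_iff by blast
qed

end
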